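(* The kissing number in dimension $10$ is at most $594$, i.e. $k(10)\le 594$.
   Context: The kissing number $k(n)$ is the maximum number of non-overlapping unit balls in $\mathbb{R}^n$ that touch a central unit ball. Equivalently, $k(n)$ is the maximum $N$ for which there are $N$ distinct unit vectors $\mathbf{x}_1,\ldots,\mathbf{x}_N\in\mathbb{R}^n$ with pairwise angular distance at least $\pi/3$, i.e. $\langle\mathbf{x}_i,\mathbf{x}_j\rangle\le\frac12$ for $i\neq j$. *)

theory Defs
  imports "HOL-Analysis.Analysis"
begin

text \<open>
  A configuration is given by the set of centres of the outer unit balls; the central unit ball
  is centred at the origin. Closed balls touch if they meet while their interiors are disjoint,
  and non-overlapping means that the interiors are disjoint.
\<close>

definition kissing_configuration :: "(real ^ 'n) set \<Rightarrow> bool" where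
  "kissing_configuration C \<longleftrightarrow>
     finite C \<and>
     (\<forall>c\<in>C. cball c 1 \<inter> cball 0 1 \<noteq> {} \<and> ball c 1 \<inter> ball 0 1 = {}) \<and>
     pairwise (\<lambda>c d. ball c 1 \<inter> ball d 1 = {}) C"

text \<open>
  The dimension is the cardinality of the index type, so \<open>kissing_number TYPE(10)\<close> is $k(10)$.
  The maximum is over a finite nonempty set, as proved in \<open>kissing_cards\<close> below.
\<close>

definition kissing_number :: "'n::finite itself \<Rightarrow> nat" where
  "kissing_number _ = Max {card C | C :: (real ^ 'n) set. kissing_configuration C}"

lemma unit_balls_disjoint_iff:
  fixes c d :: "real ^ 'n"
  shows "ball c 1 \<inter> ball d 1 = {} \<longleftrightarrow> 2 \<le> dist c d"
proof
  assume disj: "ball c 1 \<inter> ball d 1 = {}"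
  show "2 \<le> dist c d"
  proof (rule ccontr)
    assume "\<not> 2 \<le> dist c d"
    then have "midpoint c d \<in> ball c 1 \<inter> ball d 1"
      by (simp add: dist_midpoint)
    with disj show False by blast
  qed
next
  assume "2 \<le> dist c d"
  then show "ball c 1 \<inter> ball d 1 = {}"
    by (intro disjoint_ballI) simp
qed

lemma unit_cballs_meet_iff:
  fixes c d :: "real ^ 'n"
  shows "cball c 1 \<inter> cball d 1 \<noteq> {} \<longleftrightarrow> dist c d \<le> 2"
proof
  assume "cball c 1 \<inter> cball d 1 \<noteq> {}"
  then obtain x where x: "dist c x \<le> 1" "dist d x \<le> 1"
    by auto
  have "dist c d \<le> dist c x + dist d x"
    by (rule dist_triangle2)
  with x show "dist c d \<le> 2" by linarith
next
  assume "dist c d \<le> 2"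
  then have "midpoint c d \<in> cball c 1 \<inter> cball d 1"
    by (simp add: dist_midpoint)
  then show "cball c 1 \<inter> cball d 1 \<noteq> {}" by blast
qed

lemma kissing_configuration_iff:
  fixes C :: "(real ^ 'n) set"
  shows "kissing_configuration C \<longleftrightarrow>
    finite C \<and> (\<forall>c\<in>C. norm c = 2) \<and> pairwise (\<lambda>c d. 2 \<le> dist c d) C"
proof -
  have "cball c 1 \<inter> cball 0 1 \<noteq> {} \<and> ball c 1 \<inter> ball 0 1 = {} \<longleftrightarrow> norm c = 2" for c :: "real ^ 'n"
    unfolding unit_cballs_meet_iff unit_balls_disjoint_iff by auto
  then show ?thesis
    unfolding kissing_configuration_def unit_balls_disjoint_iff by simp
qed

lemma kissing_cards:
  shows "finite {card C | C :: (real ^ 'n) set. kissing_configuration C}" (is "finite ?K")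
    and "{card C | C :: (real ^ 'n) set. kissing_configuration C} \<noteq> {}"
proof -
  have "compact (sphere 0 2 :: (real ^ 'n) set)" by simp
  then obtain F :: "(real ^ 'n) set"
    where F: "finite F" "sphere 0 2 \<subseteq> (\<Union>x\<in>F. ball x 1)"
    unfolding compact_eq_totally_bounded by (metis zero_less_one)
  have "card C \<le> card F" if C: "kissing_configuration C" for C :: "(real ^ 'n) set"
  proof -
    have "\<forall>c\<in>C. \<exists>x. x \<in> F \<and> dist x c < 1"
      using C F(2) by (fastforce simp: kissing_configuration_iff subset_iff)
    then obtain g where g: "\<And>c. c \<in> C \<Longrightarrow> g c \<in> F \<and> dist (g c) c < 1"
      by metis
    have "inj_on g C"
    proof (rule inj_onI, rule ccontr)
      fix c d assume cd: "c \<in> C" "d \<in> C" "g c = g d" "c \<noteq> d"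
      then have "2 \<le> dist c d"
        using C by (auto simp: kissing_configuration_iff pairwise_def)
      moreover have "dist c d \<le> dist (g c) c + dist (g c) d"
        by (rule dist_triangle3)
      moreover have "dist (g c) c < 1" "dist (g c) d < 1"
        using g[of c] g[of d] cd by auto
      ultimately show False by linarith
    qed
    moreover have "g ` C \<subseteq> F" using g by blast
    ultimately show ?thesis using F(1) by (metis card_inj_on_le)
  qed
  then have "?K \<subseteq> {..card F}" by auto
  then show "finite ?K" by (rule finite_subset) simp
  have "kissing_configuration ({} :: (real ^ 'n) set)"
    by (simp add: kissing_configuration_def)
  then show "?K \<noteq> {}" by blast
qed

text \<open>The equivalent description by unit vectors at pairwise angular distance at least $\pi/3$.\<close>

lemma kissing_configuration_unit_vectors:
  fixes X :: "(real ^ 'n) set"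
  shows "kissing_configuration ((*\<^sub>R) 2 ` X) \<longleftrightarrow>
    finite X \<and> (\<forall>x\<in>X. norm x = 1) \<and> pairwise (\<lambda>x y. x \<bullet> y \<le> 1 / 2) X"
proof -
  have inj: "inj_on ((*\<^sub>R) 2) X" by (simp add: inj_on_def)
  have key: "2 \<le> dist (2 *\<^sub>R x) (2 *\<^sub>R y) \<longleftrightarrow> x \<bullet> y \<le> 1 / 2"
    if "norm x = 1" "norm y = 1" for x y :: "real ^ 'n"
  proof -
    have "2 \<le> dist (2 *\<^sub>R x) (2 *\<^sub>R y) \<longleftrightarrow> 1 \<le> norm (x - y)"
      by (simp add: dist_norm flip: scaleR_diff_right)
    also have "\<dots> \<longleftrightarrow> 1\<^sup>2 \<le> (norm (x - y))\<^sup>2"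
      by (simp add: abs_le_square_iff[of 1 "norm (x - y)", simplified])
    also have "(norm (x - y))\<^sup>2 = 2 - 2 * (x \<bullet> y)"
      using that by (simp add: power2_norm_eq_inner inner_diff inner_commute norm_eq_1)
    finally show ?thesis by auto
  qed
  show ?thesis
    unfolding kissing_configuration_iff
    by (auto simp: finite_image_iff[OF inj] pairwise_image pairwise_def key)
qed

lemma kissing_number_unit_vectors:
  "kissing_number TYPE('n::finite) =
     Max {card X | X :: (real ^ 'n) set.
       finite X \<and> (\<forall>x\<in>X. norm x = 1) \<and> pairwise (\<lambda>x y. x \<bullet> y \<le> 1 / 2) X}"
proof -
  have surj: "\<exists>X. C = (*\<^sub>R) 2 ` X" for C :: "(real ^ 'n) set"
    by (rule exI[of _ "(*\<^sub>R) (1 / 2) ` C"]) (simp add: image_image)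
  have card: "card ((*\<^sub>R) 2 ` X) = card X" for X :: "(real ^ 'n) set"
    by (rule card_image) (simp add: inj_on_def)
  have "{card C | C :: (real ^ 'n) set. kissing_configuration C} =
      {card X | X :: (real ^ 'n) set. kissing_configuration ((*\<^sub>R) 2 ` X)}"
    using surj card by (auto 0 4; metis)
  then show ?thesis
    unfolding kissing_number_def kissing_configuration_unit_vectors by simp
qed

end

theory Submission
  imports Defs
begin

text \<open>
  The argument is the linear programming bound of Delsarte, with Pfender's modification.
  If \<open>f = \<Sum>\<^sub>k c\<^sub>k G\<^sub>k\<close> is a nonnegative combination of Gegenbauer polynomials, then
  \<open>\<Sum>\<^sub>x \<Sum>\<^sub>y f (x \<bullet> y) \<ge> c\<^sub>0 N\<^sup>2\<close> for every set of \<open>N\<close> unit vectors. Delsarte's condition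
  \<open>f \<le> 0\<close> on \<open>[-1, 1/2]\<close> cannot give less than 595 in dimension 10. It is relaxed to
  \<open>f t \<le> \<lambda> (- t - a)\<close> on \<open>[-1, -a]\<close>, where \<open>2 a\<^sup>2 \<ge> 1\<close>: by the Cauchy-Schwarz inequality the
  neighbours \<open>y\<close> of the antipode of \<open>x\<close> satisfy \<open>\<Sum>\<^sub>y (- x \<bullet> y - a) \<le> 1 / (4 a)\<close>, so they
  contribute at most \<open>\<lambda> / (4 a)\<close> to the row of \<open>x\<close>, and \<open>c\<^sub>0 N \<le> f 1 + \<lambda> / (4 a)\<close>.

  Positive definiteness of \<open>G\<^sub>k\<close> comes from the Fischer inner product \<open>\<langle>p, q\<rangle> = p(\<partial>) q\<close> on homogeneous
  polynomials, for which multiplication by \<open>|z|\<^sup>2\<close> is adjoint to the Laplacian: \<open>G\<^sub>k (x \<bullet> y)\<close> is the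
  inner product of the harmonic projections of \<open>(x \<bullet> z)\<^sup>k / k!\<close> and \<open>(y \<bullet> z)\<^sup>k / k!\<close>.
\<close>

section \<open>The Fischer inner product\<close>

text \<open>
  A formal power series in the variables \<open>z\<^sub>i\<close> is represented by its coefficients, indexed by the
  exponents \<open>\<alpha> :: 'n \<Rightarrow> nat\<close>; \<open>fischer k\<close> only sees the homogeneous parts of degree \<open>k\<close>.
\<close>

definition mdeg :: "('n::finite \<Rightarrow> nat) \<Rightarrow> nat"
  where "mdeg \<alpha> = sum \<alpha> UNIV"

definition mult_var :: "'n \<Rightarrow> (('n \<Rightarrow> nat) \<Rightarrow> real) \<Rightarrow> ('n \<Rightarrow> nat) \<Rightarrow> real"
  where "mult_var i p \<alpha> = (if \<alpha> i = 0 then 0 else p (\<alpha>(i := \<alpha> i - 1)))"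

definition diff_var :: "'n \<Rightarrow> (('n \<Rightarrow> nat) \<Rightarrow> real) \<Rightarrow> ('n \<Rightarrow> nat) \<Rightarrow> real"
  where "diff_var i p \<alpha> = (real (\<alpha> i) + 1) * p (\<alpha>(i := Suc (\<alpha> i)))"

definition mult_sqnorm :: "(('n::finite \<Rightarrow> nat) \<Rightarrow> real) \<Rightarrow> ('n \<Rightarrow> nat) \<Rightarrow> real"
  where "mult_sqnorm p \<alpha> = (\<Sum>i\<in>UNIV. mult_var i (mult_var i p) \<alpha>)"

definition laplacian :: "(('n::finite \<Rightarrow> nat) \<Rightarrow> real) \<Rightarrow> ('n \<Rightarrow> nat) \<Rightarrow> real"
  where "laplacian p \<alpha> = (\<Sum>i\<in>UNIV. diff_var i (diff_var i p) \<alpha>)"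

definition fischer :: "nat \<Rightarrow> (('n::finite \<Rightarrow> nat) \<Rightarrow> real) \<Rightarrow> (('n \<Rightarrow> nat) \<Rightarrow> real) \<Rightarrow> real"
  where "fischer k p q = (\<Sum>\<alpha> | mdeg \<alpha> = k. (\<Prod>i\<in>UNIV. fact (\<alpha> i)) * p \<alpha> * q \<alpha>)"

lemma finite_mdeg: "finite {\<alpha> :: 'n::finite \<Rightarrow> nat. mdeg \<alpha> = k}"
proof (rule finite_subset)
  show "{\<alpha> :: 'n \<Rightarrow> nat. mdeg \<alpha> = k} \<subseteq> PiE UNIV (\<lambda>_. {..k})"
    by (auto simp: mdeg_def intro: member_le_sum)
qed (simp add: finite_PiE)

lemma mdeg_upd: "mdeg (\<alpha>(i := m)) + \<alpha> i = mdeg \<alpha> + m"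
proof -
  have "sum (\<alpha>(i := m)) (UNIV - {i}) = sum \<alpha> (UNIV - {i})"
    by (rule sum.cong) auto
  then show ?thesis
    unfolding mdeg_def by (simp add: sum.remove[of UNIV i])
qed

lemma prod_UNIV_upd:
  fixes \<alpha> :: "'n::finite \<Rightarrow> nat" and f :: "'n \<Rightarrow> nat \<Rightarrow> real"
  shows "(\<Prod>j\<in>UNIV. f j ((\<alpha>(i := m)) j)) = f i m * (\<Prod>j\<in>UNIV - {i}. f j (\<alpha> j))"
proof -
  have "(\<Prod>j\<in>UNIV - {i}. f j ((\<alpha>(i := m)) j)) = (\<Prod>j\<in>UNIV - {i}. f j (\<alpha> j))"
    by (rule prod.cong) auto
  then show ?thesis by (subst prod.remove[of UNIV i]) simp_all
qed

text \<open>Lowering the exponent of \<open>z_i\<close> divides the factorial weight by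
  \<open>\<alpha> i\<close>, which is the factor that differentiation produces.\<close>

lemma fischer_mult_var:
  fixes p q :: "('n::finite \<Rightarrow> nat) \<Rightarrow> real"
  shows "fischer (Suc k) (mult_var i p) q = fischer k p (diff_var i q)"
proof -
  let ?up = "\<lambda>\<alpha> :: 'n \<Rightarrow> nat. \<alpha>(i := Suc (\<alpha> i))"
  let ?down = "\<lambda>\<alpha> :: 'n \<Rightarrow> nat. \<alpha>(i := \<alpha> i - 1)"
  have "fischer (Suc k) (mult_var i p) q =
      (\<Sum>\<alpha> | mdeg \<alpha> = Suc k \<and> \<alpha> i \<noteq> 0. (\<Prod>j\<in>UNIV. fact (\<alpha> j)) * mult_var i p \<alpha> * q \<alpha>)"
    unfolding fischer_def by (rule sum.mono_neutral_right) (auto simp: finite_mdeg mult_var_def)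
  also have "\<dots> = fischer k p (diff_var i q)"
    unfolding fischer_def
  proof (rule sum.reindex_bij_witness[where i = ?up and j = ?down])
    fix \<alpha> assume "\<alpha> \<in> {\<alpha>. mdeg \<alpha> = Suc k \<and> \<alpha> i \<noteq> 0}"
    then obtain m where \<alpha>: "mdeg \<alpha> = Suc k" and m: "\<alpha> i = Suc m"
      by (cases "\<alpha> i") auto
    show "?up (?down \<alpha>) = \<alpha>" using m by auto
    show "?down \<alpha> \<in> {\<alpha>. mdeg \<alpha> = k}"
      using mdeg_upd[of \<alpha> i m] \<alpha> m by simp
    have "(\<Prod>j\<in>UNIV. fact (\<alpha> j) :: real) = real (\<alpha> i) * (\<Prod>j\<in>UNIV. fact (?down \<alpha> j))"
      unfolding prod_UNIV_upd[of "\<lambda>_. fact"] using m prod.remove[of UNIV i "\<lambda>j. fact (\<alpha> j) :: real"]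
      by (simp add: mult.assoc)
    then show "(\<Prod>j\<in>UNIV. fact (?down \<alpha> j)) * p (?down \<alpha>) * diff_var i q (?down \<alpha>) =
        (\<Prod>j\<in>UNIV. fact (\<alpha> j)) * mult_var i p \<alpha> * q \<alpha>"
      using m by (simp add: mult_var_def diff_var_def fun_upd_idem)
  next
    fix \<alpha> :: "'n \<Rightarrow> nat" assume "\<alpha> \<in> {\<alpha>. mdeg \<alpha> = k}"
    then show "?up \<alpha> \<in> {\<alpha>. mdeg \<alpha> = Suc k \<and> \<alpha> i \<noteq> 0}"
      using mdeg_upd[of \<alpha> i "Suc (\<alpha> i)"] by simp
    show "?down (?up \<alpha>) = \<alpha>" by simp
  qed
  finally show ?thesis .
qed

lemma fischer_commute: "fischer k p q = fischer k q p"
  unfolding fischer_def by (simp add: mult.assoc mult.commute[of "p _"])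

lemma fischer_sum_left: "fischer k (\<lambda>\<alpha>. \<Sum>i\<in>I. p i \<alpha>) q = (\<Sum>i\<in>I. fischer k (p i) q)"
  unfolding fischer_def sum_distrib_left sum_distrib_right by (rule sum.swap)

lemma fischer_sum_right: "fischer k q (\<lambda>\<alpha>. \<Sum>i\<in>I. p i \<alpha>) = (\<Sum>i\<in>I. fischer k q (p i))"
  unfolding fischer_commute[of k q] by (rule fischer_sum_left)

lemma fischer_scale_left: "fischer k (\<lambda>\<alpha>. c * p \<alpha>) q = c * fischer k p q"
  unfolding fischer_def sum_distrib_left by (simp add: algebra_simps)

lemma fischer_scale_right: "fischer k q (\<lambda>\<alpha>. c * p \<alpha>) = c * fischer k q p"
  unfolding fischer_commute[of k q] by (rule fischer_scale_left)

lemma fischer_self_nonneg: "0 \<le> fischer k p p"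
  unfolding fischer_def by (intro sum_nonneg) (simp add: mult.assoc prod_nonneg)

lemma fischer_mult_sqnorm:
  "fischer (Suc (Suc k)) (mult_sqnorm p) q = fischer k p (laplacian q)"
  unfolding mult_sqnorm_def[abs_def] laplacian_def[abs_def]
  by (simp add: fischer_sum_left fischer_sum_right fischer_mult_var)

section \<open>Commuting the Laplacian past powers of |z|^2\<close>

lemma mult_var_twice:
  "mult_var i (mult_var i p) \<alpha> = (if \<alpha> i \<le> 1 then 0 else p (\<alpha>(i := \<alpha> i - 2)))"
  by (auto simp: mult_var_def numeral_2_eq_2)

lemma mult_sqnorm_power_low_degree:
  "mdeg \<alpha> < 2 * j \<Longrightarrow> (mult_sqnorm ^^ j) p \<alpha> = 0"
proof (induction j arbitrary: \<alpha>)
  case (Suc j)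
  have "mult_var i (mult_var i ((mult_sqnorm ^^ j) p)) \<alpha> = 0" for i
  proof (cases "\<alpha> i \<le> 1")
    case False
    then have "mdeg (\<alpha>(i := \<alpha> i - 2)) < 2 * j"
      using mdeg_upd[of \<alpha> i "\<alpha> i - 2"] Suc.prems by simp
    from Suc.IH[OF this] show ?thesis
      by (simp add: mult_var_twice del: fun_upd_apply)
  qed (simp add: mult_var_twice)
  then show ?case
    unfolding funpow.simps comp_apply mult_sqnorm_def[of "(mult_sqnorm ^^ j) p"] by simp
qed simp

text \<open>For i = j this is the commutator [d^2, z^2] = 4 z d + 2, where z d multiplies the
  coefficient at \<alpha> by \<open>\<alpha> i\<close>.\<close>

lemma diff2_mult2_var:
  "diff_var i (diff_var i (mult_var j (mult_var j p))) \<alpha> =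
     mult_var j (mult_var j (diff_var i (diff_var i p))) \<alpha>
       + (if i = j then (4 * real (\<alpha> i) + 2) * p \<alpha> else 0)"
proof (cases "i = j")
  case True
  consider "\<alpha> j = 0" | "\<alpha> j = 1" | m where "\<alpha> j = Suc (Suc m)"
    by (metis One_nat_def not0_implies_Suc)
  then show ?thesis
    by cases (simp_all add: True diff_var_def mult_var_def fun_upd_idem algebra_simps)
next
  case False
  then show ?thesis
    by (simp add: diff_var_def mult_var_def fun_upd_twist)
qed

lemma laplacian_mult_sqnorm:
  fixes p :: "('n::finite \<Rightarrow> nat) \<Rightarrow> real"
  shows "laplacian (mult_sqnorm p) \<alpha> =
    mult_sqnorm (laplacian p) \<alpha> + (4 * real (mdeg \<alpha>) + 2 * real CARD('n)) * p \<alpha>"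
proof -
  have "laplacian (mult_sqnorm p) \<alpha> = (\<Sum>i\<in>UNIV. \<Sum>j\<in>UNIV. diff_var i (diff_var i (mult_var j (mult_var j p))) \<alpha>)"
    unfolding laplacian_def mult_sqnorm_def[abs_def]
    by (simp add: diff_var_def sum_distrib_left)
  also have "\<dots> = (\<Sum>i\<in>UNIV. \<Sum>j\<in>UNIV. mult_var j (mult_var j (diff_var i (diff_var i p))) \<alpha>)
      + (\<Sum>i\<in>UNIV. (4 * real (\<alpha> i) + 2) * p \<alpha>)"
    unfolding diff2_mult2_var sum.distrib by simp
  also have "(\<Sum>i\<in>UNIV. \<Sum>j\<in>UNIV. mult_var j (mult_var j (diff_var i (diff_var i p))) \<alpha>) = mult_sqnorm (laplacian p) \<alpha>"
    unfolding laplacian_def[abs_def] mult_sqnorm_def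
    by (subst sum.swap) (auto intro!: sum.cong simp: mult_var_def)
  also have "(\<Sum>i\<in>UNIV. (4 * real (\<alpha> i) + 2) * p \<alpha>) = (4 * real (mdeg \<alpha>) + 2 * real CARD('n)) * p \<alpha>"
    by (simp add: mdeg_def sum.distrib flip: sum_distrib_left sum_distrib_right)
  finally show ?thesis .
qed

text \<open>Multiplication by |z|^2 raises degrees by 2, hence the shift. Below degree 2, where the
  argument of \<open>c\<close> is negative, its factor vanishes.\<close>

lemma mult_sqnorm_weight:
  "mult_sqnorm (\<lambda>\<beta>. p \<beta> + c (real (mdeg \<beta>)) * q \<beta>) \<alpha> =
     mult_sqnorm p \<alpha> + c (real (mdeg \<alpha>) - 2) * mult_sqnorm q \<alpha>"
proof -
  have "mult_var i (mult_var i (\<lambda>\<beta>. p \<beta> + c (real (mdeg \<beta>)) * q \<beta>)) \<alpha> =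
      mult_var i (mult_var i p) \<alpha> + c (real (mdeg \<alpha>) - 2) * mult_var i (mult_var i q) \<alpha>" for i
  proof (cases "\<alpha> i \<le> 1")
    case False
    then have "real (mdeg (\<alpha>(i := \<alpha> i - 2))) = real (mdeg \<alpha>) - 2"
      using mdeg_upd[of \<alpha> i "\<alpha> i - 2"] by linarith
    then show ?thesis by (simp add: mult_var_twice)
  qed (simp add: mult_var_twice)
  then show ?thesis
    by (simp add: mult_sqnorm_def sum.distrib sum_distrib_left)
qed

text \<open>With m = \<open>mdeg \<alpha>\<close>, the constant is the sum of the commutators 4 (m -
  2 i) + 2 n over i \<le> j.\<close>

lemma laplacian_mult_sqnorm_power:
  fixes p :: "('n::finite \<Rightarrow> nat) \<Rightarrow> real"
  shows "laplacian ((mult_sqnorm ^^ Suc j) p) \<alpha> = (mult_sqnorm ^^ Suc j) (laplacian p) \<alpha>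
    + (real j + 1) * (4 * real (mdeg \<alpha>) + 2 * real CARD('n) - 4 * real j) * (mult_sqnorm ^^ j) p \<alpha>"
proof (induction j arbitrary: \<alpha>)
  case 0
  then show ?case by (simp add: laplacian_mult_sqnorm)
next
  case (Suc j)
  have "laplacian ((mult_sqnorm ^^ Suc (Suc j)) p) \<alpha> =
     mult_sqnorm (laplacian ((mult_sqnorm ^^ Suc j) p)) \<alpha>
      + (4 * real (mdeg \<alpha>) + 2 * real CARD('n)) * (mult_sqnorm ^^ Suc j) p \<alpha>"
    using laplacian_mult_sqnorm[of "(mult_sqnorm ^^ Suc j) p" \<alpha>] by simp
  also have "laplacian ((mult_sqnorm ^^ Suc j) p) = (\<lambda>\<beta>. (mult_sqnorm ^^ Suc j) (laplacian p) \<beta>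
    + (\<lambda>m. (real j + 1) * (4 * m + 2 * real CARD('n) - 4 * real j)) (real (mdeg \<beta>)) * (mult_sqnorm ^^ j) p \<beta>)"
    using Suc.IH by fastforce
  also have "mult_sqnorm \<dots> \<alpha> = mult_sqnorm ((mult_sqnorm ^^ Suc j) (laplacian p)) \<alpha>
     + (real j + 1) * (4 * (real (mdeg \<alpha>) - 2) + 2 * real CARD('n) - 4 * real j) * mult_sqnorm ((mult_sqnorm ^^ j) p) \<alpha>"
    by (subst mult_sqnorm_weight) simp
  finally show ?case by (simp add: algebra_simps)
qed

text \<open>The power series \<open>exp (x \<bullet> z)\<close>, whose part of degree \<open>k\<close> is \<open>(x \<bullet> z)\<^sup>k / k!\<close>.\<close>

definition exp_coeffs :: "real ^ 'n \<Rightarrow> ('n::finite \<Rightarrow> nat) \<Rightarrow> real"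
  where "exp_coeffs x \<alpha> = (\<Prod>i\<in>UNIV. (x $ i) ^ \<alpha> i / fact (\<alpha> i))"

lemma diff_var_exp_coeffs: "diff_var i (exp_coeffs x) = (\<lambda>\<alpha>. x $ i * exp_coeffs x \<alpha>)"
proof
  fix \<alpha>
  show "diff_var i (exp_coeffs x) \<alpha> = x $ i * exp_coeffs x \<alpha>"
    unfolding diff_var_def exp_coeffs_def prod_UNIV_upd[of "\<lambda>j a. x $ j ^ a / fact a"]
    by (simp add: prod.remove[of UNIV i] field_simps del: of_nat_Suc)
      (simp add: algebra_simps)
qed

lemma laplacian_exp_coeffs:
  assumes "norm x = 1"
  shows "laplacian (exp_coeffs x) = exp_coeffs x"
proof
  fix \<alpha>
  have "diff_var i (diff_var i (exp_coeffs x)) \<alpha> = (x $ i * x $ i) * exp_coeffs x \<alpha>" for i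
    unfolding diff_var_exp_coeffs using fun_cong[OF diff_var_exp_coeffs[of i x], of \<alpha>]
    by (simp add: diff_var_def)
  then have "laplacian (exp_coeffs x) \<alpha> = (x \<bullet> x) * exp_coeffs x \<alpha>"
    by (simp add: laplacian_def inner_vec_def sum_distrib_right)
  then show "laplacian (exp_coeffs x) \<alpha> = exp_coeffs x \<alpha>"
    using assms by (simp add: norm_eq_1)
qed

text \<open>Euler's identity for the degree operator, the sum of all z_i d_i, combined with
  adjointness.\<close>

lemma fischer_Suc:
  "(real k + 1) * fischer (Suc k) p q = (\<Sum>i\<in>UNIV. fischer k (diff_var i p) (diff_var i q))"
proof -
  have "(\<Sum>i\<in>UNIV. fischer k (diff_var i p) (diff_var i q)) =
      fischer (Suc k) (\<lambda>\<alpha>. \<Sum>i\<in>UNIV. mult_var i (diff_var i p) \<alpha>) q"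
    by (simp add: fischer_mult_var fischer_sum_left)
  also have "\<dots> = fischer (Suc k) (\<lambda>\<alpha>. real (mdeg \<alpha>) * p \<alpha>) q"
  proof -
    have "mult_var i (diff_var i p) \<alpha> = real (\<alpha> i) * p \<alpha>" for i \<alpha>
      by (simp add: mult_var_def diff_var_def)
    then show ?thesis by (simp add: mdeg_def sum_distrib_right)
  qed
  also have "\<dots> = (real k + 1) * fischer (Suc k) p q"
    unfolding fischer_def sum_distrib_left by (rule sum.cong) simp_all
  finally show ?thesis by simp
qed

lemma fischer_exp_coeffs: "fischer k (exp_coeffs x) (exp_coeffs y) = (x \<bullet> y) ^ k / fact k"
proof (induction k)
  case 0
  have "{\<alpha> :: 'a \<Rightarrow> nat. mdeg \<alpha> = 0} = {\<lambda>_. 0}"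
    by (auto simp: mdeg_def)
  then show ?case by (simp add: fischer_def exp_coeffs_def)
next
  case (Suc k)
  have "(real k + 1) * fischer (Suc k) (exp_coeffs x) (exp_coeffs y) =
      (x \<bullet> y) * fischer k (exp_coeffs x) (exp_coeffs y)"
    unfolding fischer_Suc diff_var_exp_coeffs fischer_scale_left fischer_scale_right
    by (simp add: inner_vec_def sum_distrib_right mult.assoc)
  also have "\<dots> = (real k + 1) * ((x \<bullet> y) ^ Suc k / fact (Suc k))"
    by (simp add: Suc.IH field_simps del: of_nat_Suc) (simp add: algebra_simps)
  finally show ?case
    by (metis add.commute mult_left_cancel of_nat_Suc of_nat_neq_0)
qed

section \<open>Positive definiteness of Gegenbauer polynomials\<close>

text \<open>
  The recursion between consecutive factors is what makes \<open>zonal\<close> below harmonic. The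
  normalisation is by the leading coefficient \<open>1 / k!\<close>, not by the value at 1.
\<close>

definition geg_coeff :: "nat \<Rightarrow> nat \<Rightarrow> nat \<Rightarrow> real"
  where "geg_coeff n k j =
    (\<Prod>i<j. - 1 / ((real i + 1) * (4 * real k - 4 * real i - 8 + 2 * real n)))"

definition gegenbauer :: "nat \<Rightarrow> nat \<Rightarrow> real \<Rightarrow> real"
  where "gegenbauer n k t = (\<Sum>j\<le>k div 2. geg_coeff n k j * (t ^ (k - 2 * j) / fact (k - 2 * j)))"

text \<open>For a unit vector x, the part of degree k is the harmonic projection of (x . z)^k / k!;
  the other degrees are irrelevant.\<close>

definition zonal :: "nat \<Rightarrow> real ^ 'n \<Rightarrow> ('n::finite \<Rightarrow> nat) \<Rightarrow> real"
  where "zonal k x \<alpha> =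
    (\<Sum>j\<le>k div 2. geg_coeff CARD('n) k j * (mult_sqnorm ^^ j) (exp_coeffs x) \<alpha>)"

lemma laplacian_sum_scale:
  "laplacian (\<lambda>\<alpha>. \<Sum>j\<in>J. c j * p j \<alpha>) \<alpha> = (\<Sum>j\<in>J. c j * laplacian (p j) \<alpha>)"
proof -
  have "laplacian (\<lambda>\<alpha>. \<Sum>j\<in>J. c j * p j \<alpha>) \<alpha> =
      (\<Sum>i\<in>UNIV. \<Sum>j\<in>J. c j * diff_var i (diff_var i (p j)) \<alpha>)"
    by (simp add: laplacian_def diff_var_def sum_distrib_left algebra_simps)
  then show ?thesis
    by (subst (asm) sum.swap) (simp add: laplacian_def sum_distrib_left)
qed

lemma geg_coeff_Suc:
  assumes "0 < n" "j \<le> m div 2"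
  shows "geg_coeff n (Suc (Suc m)) (Suc j) * ((real j + 1) * (4 * real m + 2 * real n - 4 * real j)) =
    - geg_coeff n (Suc (Suc m)) j"
proof -
  define d where "d = (real j + 1) * (4 * real m + 2 * real n - 4 * real j)"
  have "real j \<le> real m" "0 < real n" using assms by auto
  then have "4 * real m + 2 * real n - 4 * real j \<noteq> 0" "real j + 1 \<noteq> 0" by linarith+
  then have "d \<noteq> 0" by (simp add: d_def)
  have "(real j + 1) * (4 * real (Suc (Suc m)) - 4 * real j - 8 + 2 * real n) = d"
    by (simp add: d_def algebra_simps)
  then have "geg_coeff n (Suc (Suc m)) (Suc j) = geg_coeff n (Suc (Suc m)) j * (- 1 / d)"
    unfolding geg_coeff_def prod.lessThan_Suc by simp
  with \<open>d \<noteq> 0\<close> show ?thesis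
    unfolding d_def[symmetric] by simp
qed

text \<open>The commutator term of each summand cancels the Laplacian of the previous one. The last
  term survives but contains too high a power of |z|^2 to reach degree k - 2.\<close>

lemma laplacian_zonal:
  assumes "norm x = 1" "Suc (Suc (mdeg \<alpha>)) = k"
  shows "laplacian (zonal k x) \<alpha> = 0"
proof -
  define b where "b = geg_coeff CARD('a) k"
  define J where "J = mdeg \<alpha> div 2"
  let ?R = "\<lambda>j. (mult_sqnorm ^^ j) (exp_coeffs x) \<alpha>"
  have k: "k div 2 = Suc J" using assms(2) by (auto simp: J_def)
  have b_Suc: "b (Suc j) * ((real j + 1) * (4 * real (mdeg \<alpha>) + 2 * real CARD('a) - 4 * real j)) = - b j"
    if "j \<le> J" for j
    using geg_coeff_Suc[of "CARD('a)" j "mdeg \<alpha>"] that assms(2) by (simp add: b_def J_def)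
  have "laplacian (zonal k x) \<alpha> = (\<Sum>j\<le>Suc J. b j * laplacian ((mult_sqnorm ^^ j) (exp_coeffs x)) \<alpha>)"
    unfolding zonal_def[abs_def] laplacian_sum_scale k b_def ..
  also have "\<dots> = b 0 * ?R 0 + (\<Sum>j\<le>J. b (Suc j) * ?R (Suc j)
      + b (Suc j) * ((real j + 1) * (4 * real (mdeg \<alpha>) + 2 * real CARD('a) - 4 * real j)) * ?R j)"
    unfolding sum.atMost_Suc_shift laplacian_mult_sqnorm_power laplacian_exp_coeffs[OF assms(1)]
    by (simp add: laplacian_exp_coeffs[OF assms(1)] algebra_simps)
  also have "\<dots> = b 0 * ?R 0 + (\<Sum>j\<le>J. b (Suc j) * ?R (Suc j) - b j * ?R j)"
    using b_Suc by (intro arg_cong2[where f = "(+)"] sum.cong) auto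
  also have "\<dots> = (\<Sum>j\<le>Suc J. b j * ?R j) - (\<Sum>j\<le>J. b j * ?R j)"
    by (simp only: sum_subtractf sum.atMost_Suc_shift)
  also have "\<dots> = b (Suc J) * ?R (Suc J)" by simp
  also have "\<dots> = 0"
    using mult_sqnorm_power_low_degree[of \<alpha> "Suc J" "exp_coeffs x"] by (simp add: J_def)
  finally show ?thesis .
qed

text \<open>Each factor |z|^2 moves across as a Laplacian, which fixes exp (x . z).\<close>

lemma fischer_exp_coeffs_mult_sqnorm_power:
  assumes "norm x = 1"
  shows "fischer (2 * j + k) (exp_coeffs x) ((mult_sqnorm ^^ j) q) = fischer k (exp_coeffs x) q"
proof (induction j)
  case (Suc j)
  have "fischer (Suc (Suc (2 * j + k))) (exp_coeffs x) (mult_sqnorm ((mult_sqnorm ^^ j) q)) =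
      fischer (2 * j + k) (laplacian (exp_coeffs x)) ((mult_sqnorm ^^ j) q)"
    by (metis fischer_commute fischer_mult_sqnorm)
  then show ?case using Suc by (simp add: laplacian_exp_coeffs[OF assms])
qed simp

text \<open>A harmonic polynomial is orthogonal to all multiples of |z|^2, so only the term j = 0 of
  \<open>zonal k x\<close> contributes.\<close>

lemma fischer_zonal:
  fixes x y :: "real ^ 'n"
  assumes "norm x = 1" "norm y = 1"
  shows "fischer k (zonal k x) (zonal k y) = gegenbauer CARD('n) k (x \<bullet> y)"
proof -
  have zonal_eq: "zonal k z =
      (\<lambda>\<alpha>. \<Sum>j\<le>k div 2. geg_coeff CARD('n) k j * (mult_sqnorm ^^ j) (exp_coeffs z) \<alpha>)" for z :: "real ^ 'n"
    by (rule ext) (rule zonal_def)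
  have "fischer k ((mult_sqnorm ^^ j) (exp_coeffs x)) (zonal k y) = 0"
    if j_le: "j \<le> k div 2" and j_pos: "j \<noteq> 0" for j
  proof -
    obtain i where j: "j = Suc i" using j_pos by (cases j) auto
    have "2 \<le> k" using j_le j_pos by linarith
    then obtain m where k: "k = Suc (Suc m)"
      unfolding le_iff_add by auto
    have "fischer m ((mult_sqnorm ^^ i) (exp_coeffs x)) (laplacian (zonal k y)) = 0"
      unfolding fischer_def using laplacian_zonal[OF assms(2)] k by (intro sum.neutral) auto
    then show ?thesis by (simp add: j k fischer_mult_sqnorm)
  qed
  then have "fischer k (zonal k x) (zonal k y) =
      (\<Sum>j\<le>k div 2. if j = 0 then fischer k (exp_coeffs x) (zonal k y) else 0)"
    unfolding zonal_eq[of x] fischer_sum_left fischer_scale_left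
    by (intro sum.cong) (auto simp: geg_coeff_def)
  also have "\<dots> = fischer k (exp_coeffs x) (zonal k y)"
    by simp
  also have "\<dots> = (\<Sum>j\<le>k div 2. geg_coeff CARD('n) k j * fischer (k - 2 * j) (exp_coeffs x) (exp_coeffs y))"
    unfolding zonal_eq fischer_sum_right fischer_scale_right
  proof (rule sum.cong)
    fix j assume "j \<in> {..k div 2}"
    then have "2 * j + (k - 2 * j) = k" by auto
    then show "geg_coeff CARD('n) k j * fischer k (exp_coeffs x) ((mult_sqnorm ^^ j) (exp_coeffs y)) =
        geg_coeff CARD('n) k j * fischer (k - 2 * j) (exp_coeffs x) (exp_coeffs y)"
      using fischer_exp_coeffs_mult_sqnorm_power[OF assms(1), of j "k - 2 * j" "exp_coeffs y"] by simp
  qed simp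
  finally show ?thesis by (simp add: gegenbauer_def fischer_exp_coeffs)
qed

theorem gegenbauer_positive_definite:
  fixes X :: "(real ^ 'n) set"
  assumes "\<And>x. x \<in> X \<Longrightarrow> norm x = 1"
  shows "0 \<le> (\<Sum>x\<in>X. \<Sum>y\<in>X. gegenbauer CARD('n) k (x \<bullet> y))"
proof -
  have "(\<Sum>x\<in>X. \<Sum>y\<in>X. gegenbauer CARD('n) k (x \<bullet> y)) =
      fischer k (\<lambda>\<alpha>. \<Sum>x\<in>X. zonal k x \<alpha>) (\<lambda>\<alpha>. \<Sum>y\<in>X. zonal k y \<alpha>)"
    unfolding fischer_sum_left fischer_sum_right
    by (intro sum.cong refl) (simp add: fischer_zonal assms)
  then show ?thesis using fischer_self_nonneg by simp
qed

section \<open>The bound in dimension 10\<close>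

lemma norm_sum_code_le:
  assumes "finite S" "\<And>y. y \<in> S \<Longrightarrow> norm y = 1" "pairwise (\<lambda>y z. y \<bullet> z \<le> 1 / 2) S"
  shows "(norm (\<Sum>S))\<^sup>2 \<le> real (card S) * (real (card S) + 1) / 2"
proof -
  have "(norm (\<Sum>S))\<^sup>2 = (\<Sum>y\<in>S. \<Sum>z\<in>S. y \<bullet> z)"
    unfolding power2_norm_eq_inner inner_sum_left inner_sum_right
    by (simp add: inner_commute)
  also have "\<dots> \<le> (\<Sum>y\<in>S. \<Sum>z\<in>S. 1 / 2 + (if y = z then 1 / 2 else 0))"
    using assms(2,3) by (intro sum_mono) (auto simp: norm_eq_1 pairwise_def)
  also have "\<dots> = (\<Sum>y\<in>S. real (card S) / 2 + 1 / 2)"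
    using assms(1) by (intro sum.cong) (simp_all add: sum.distrib)
  also have "\<dots> = real (card S) * (real (card S) + 1) / 2"
    by (simp add: field_simps)
  finally show ?thesis .
qed

lemma cap_sum_le:
  assumes "finite S" "\<And>y. y \<in> S \<Longrightarrow> norm y = 1" "pairwise (\<lambda>y z. y \<bullet> z \<le> 1 / 2) S"
    and "norm x = 1" "0 < a" "1 \<le> 2 * a\<^sup>2"
  shows "(\<Sum>y\<in>S. - (x \<bullet> y) - a) \<le> 1 / (4 * a)"
proof -
  define m where "m = real (card S)"
  have m: "0 \<le> m" by (simp add: m_def)
  have "(norm (\<Sum>S))\<^sup>2 \<le> m * (m + 1) / 2"
    using norm_sum_code_le[OF assms(1-3)] by (simp add: m_def)
  also have "\<dots> \<le> a\<^sup>2 * m\<^sup>2 + m / 2"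
    using mult_right_mono[OF assms(6), of "m\<^sup>2"] by (simp add: power2_eq_square algebra_simps)
  \<comment> \<open>The shift 1 / (4 a) completes the square: its cross term is m / 2.\<close>
  also have "\<dots> \<le> (a * m + 1 / (4 * a))\<^sup>2"
    using \<open>0 < a\<close> by (simp add: power2_eq_square field_simps)
  finally have "norm (\<Sum>S) \<le> a * m + 1 / (4 * a)"
    by (rule power2_le_imp_le) (use \<open>0 < a\<close> m in simp)
  moreover have "- (x \<bullet> \<Sum>S) \<le> norm (\<Sum>S)"
    using norm_cauchy_schwarz[of "- x" "\<Sum>S"] by (simp only: inner_minus_left norm_minus_cancel \<open>norm x = 1\<close> mult_1)
  moreover have "(\<Sum>y\<in>S. - (x \<bullet> y) - a) = - (x \<bullet> \<Sum>S) - a * m"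
    by (simp add: sum_subtractf sum_negf inner_sum_right m_def)
  ultimately show ?thesis by linarith
qed

text \<open>
  Found numerically: the double roots approximate those of the optimal polynomial of degree 11
  for \<open>a = 17 / 24\<close>, and the cubic factor was rounded so that the small Gegenbauer coefficients
  of degrees 8, 9 and 10 stay positive.
\<close>

definition lp_poly :: "real \<Rightarrow> real"
  where "lp_poly t = (2 * t - 1) * (24 * t + 17) * ((12 * t + 5) * (9 * t + 2) * (12 * t - 1))\<^sup>2
    * (364 * t ^ 3 - 480 * t\<^sup>2 - 178 * t + 465)"

text \<open>All coefficients are positive, so positive definiteness leaves only the first one as a
  lower bound.\<close>

lemma lp_poly_gegenbauer:
  "lp_poly t = 701888475 / 14 * gegenbauer 10 0 t + 2815510254 / 7 * gegenbauer 10 1 t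
    + 48104680775 / 14 * gegenbauer 10 2 t + 29997510063 * gegenbauer 10 3 t
    + 2831084999040 / 11 * gegenbauer 10 4 t + 22233242001312 / 11 * gegenbauer 10 5 t
    + 150334459574400 / 11 * gegenbauer 10 6 t + 64064016737280 * gegenbauer 10 7 t
    + 589433241600 / 13 * gegenbauer 10 8 t + 90296156160 * gegenbauer 10 9 t
    + 81266540544000 * gegenbauer 10 10 t + 1171408422017433600 * gegenbauer 10 11 t"
proof -
  have "lp_poly t = - 790500 + 8830700 * t + 88311575 * t ^ 2 - 497441924 * t ^ 3 - 5098814900 * t ^ 4
     - 8142865740 * t ^ 5 + 19002802680 * t ^ 6 + 52618417344 * t ^ 7 - 37635840 * t ^ 8
     - 57644172288 * t ^ 9 + 22394880 * t ^ 10 + 29346250752 * t ^ 11"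
    unfolding lp_poly_def by algebra
  then show ?thesis
    by (simp add: gegenbauer_def geg_coeff_def atMost_nat_numeral lessThan_nat_numeral fact_numeral)
      (simp add: field_simps)
qed

lemma lp_poly_nonpos:
  assumes "- 17 / 24 \<le> t" "t \<le> 1 / 2"
  shows "lp_poly t \<le> 0"
proof -
  \<comment> \<open>The cubic factor has positive Bernstein coefficients on \<open>[-17/24, 1/2]\<close>.\<close>
  define u v where "u = 24 * t + 17" and "v = 1 - 2 * t"
  have "0 \<le> u" "0 \<le> v" using assms by (simp_all add: u_def v_def)
  then have "0 \<le> 763381 * v ^ 3 + 556209 * u * v\<^sup>2 + 32873 * u\<^sup>2 * v + 603 * u ^ 3"
    by (intro add_nonneg_nonneg mult_nonneg_nonneg zero_le_power) simp_all
  \<comment> \<open>Homogenised by u + 12 v = 29; the factor 2 * 29^3 clears denominators.\<close>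
  also have "\<dots> = 48778 * (364 * t ^ 3 - 480 * t\<^sup>2 - 178 * t + 465)"
    unfolding u_def v_def by algebra
  finally have "0 \<le> 364 * t ^ 3 - 480 * t\<^sup>2 - 178 * t + 465"
    by simp
  then show ?thesis
    unfolding lp_poly_def using assms by (intro mult_nonpos_nonneg) auto
qed

lemma lp_poly_le_linear:
  assumes "- 1 \<le> t" "t \<le> - 17 / 24"
  shows "lp_poly t \<le> 19400000 * (- 24 * t - 17)"
proof -
  \<comment> \<open>\<open>g\<close> is \<open>lp_poly t\<close> divided by -24 t - 17, which is
    nonnegative here, so a constant bound on \<open>g\<close> suffices.\<close>
  define g where "g = (1 - 2 * t) * ((12 * t + 5) * (9 * t + 2) * (12 * t - 1))\<^sup>2
    * (364 * t ^ 3 - 480 * t\<^sup>2 - 178 * t + 465)"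
  \<comment> \<open>Both cases expand \<open>19400000 - g\<close> in Bernstein form, on \<open>[-1, -4/5]\<close> and \<open>[-4/5, -7/10]\<close>.\<close>
  have "g \<le> 19400000"
  proof (cases "t \<le> - 4 / 5")
    case True
    define u v where "u = 5 * t + 5" and "v = - 4 - 5 * t"
    have "0 \<le> u" "0 \<le> v" using assms True by (simp_all add: u_def v_def)
    then have "0 \<le> 2578893623046875 * v ^ 10 + 17265226789062500 * u * v ^ 9
       + 50591772259375000 * u ^ 2 * v ^ 8 + 84751517790312500 * u ^ 3 * v ^ 7
       + 88778738976843750 * u ^ 4 * v ^ 6 + 59560271526050000 * u ^ 5 * v ^ 5
       + 25020127108007500 * u ^ 6 * v ^ 4 + 6056593503514500 * u ^ 7 * v ^ 3
       + 682375721583775 * u ^ 8 * v ^ 2 + 21938803218580 * u ^ 9 * v + 3641946061628 * u ^ 10"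
      by (intro add_nonneg_nonneg mult_nonneg_nonneg zero_le_power) simp_all
    \<comment> \<open>Here and below u + v = 1; the factors 5^10 and 8 * 5^10 clear
      denominators.\<close>
    also have "\<dots> = 9765625 * (19400000 - g)"
      unfolding g_def u_def v_def by algebra
    finally show ?thesis by simp
  next
    case False
    \<comment> \<open>The right end -17/24 is relaxed to the rounder -7/10.\<close>
    define u v where "u = 10 * t + 8" and "v = - 7 - 10 * t"
    have "0 \<le> u" "0 \<le> v" using assms False by (simp_all add: u_def v_def)
    then have "0 \<le> 29135568493024 * v ^ 10 + 349278314521040 * u * v ^ 9
       + 3130032379282910 * u ^ 2 * v ^ 8 + 15012156811350900 * u ^ 3 * v ^ 7
       + 40991321090933570 * u ^ 4 * v ^ 6 + 69242179667384257 * u ^ 5 * v ^ 5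
       + 75563068981757010 * u ^ 6 * v ^ 4 + 53669472392528290 * u ^ 7 * v ^ 3
       + 24059319737043050 * u ^ 8 * v ^ 2 + 6202537809439105 * u ^ 9 * v + 702747247266844 * u ^ 10"
      by (intro add_nonneg_nonneg mult_nonneg_nonneg zero_le_power) simp_all
    also have "\<dots> = 78125000 * (19400000 - g)"
      unfolding g_def u_def v_def by algebra
    finally show ?thesis by simp
  qed
  then have "g * (- 24 * t - 17) \<le> 19400000 * (- 24 * t - 17)"
    using assms by (intro mult_right_mono) auto
  also have "g * (- 24 * t - 17) = lp_poly t"
    unfolding g_def lp_poly_def by algebra
  finally show ?thesis .
qed

lemma lp_poly_row_sum_le:
  fixes X :: "(real ^ 'n) set"
  assumes "finite X" "\<And>x. x \<in> X \<Longrightarrow> norm x = 1" "pairwise (\<lambda>x y. x \<bullet> y \<le> 1 / 2) X"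
    and "x \<in> X"
  shows "(\<Sum>y\<in>X. lp_poly (x \<bullet> y)) \<le> lp_poly 1 + 19400000 * (144 / 17)"
proof -
  define cap where "cap = {y \<in> X - {x}. x \<bullet> y \<le> - 17 / 24}"
  have "(\<Sum>y\<in>X - {x}. lp_poly (x \<bullet> y)) \<le>
      (\<Sum>y\<in>X - {x}. if x \<bullet> y \<le> - 17 / 24 then 19400000 * (- 24 * (x \<bullet> y) - 17) else 0)"
  proof (rule sum_mono)
    fix y assume y: "y \<in> X - {x}"
    then have "x \<bullet> y \<le> 1 / 2"
      using assms(3,4) by (auto simp: pairwise_def)
    moreover have "- 1 \<le> x \<bullet> y"
      using norm_cauchy_schwarz[of "- x" y] assms(2,4) y by simp
    ultimately show "lp_poly (x \<bullet> y) \<le>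
        (if x \<bullet> y \<le> - 17 / 24 then 19400000 * (- 24 * (x \<bullet> y) - 17) else 0)"
      using lp_poly_le_linear[of "x \<bullet> y"] lp_poly_nonpos[of "x \<bullet> y"] by auto
  qed
  also have "\<dots> = (\<Sum>y\<in>cap. 19400000 * (- 24 * (x \<bullet> y) - 17))"
    using assms(1) unfolding cap_def by (intro sum.inter_filter[symmetric]) simp
  also have "\<dots> = 19400000 * 24 * (\<Sum>y\<in>cap. - (x \<bullet> y) - 17 / 24)"
    unfolding sum_distrib_left by (rule sum.cong) (simp_all add: algebra_simps)
  \<comment> \<open>Here a = 17/24, just above 1 / sqrt 2, and the slope is 24 * 19400000.\<close>
  also have "\<dots> \<le> 19400000 * 24 * (1 / (4 * (17 / 24)))"
  proof (rule mult_left_mono[OF cap_sum_le])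
    show "pairwise (\<lambda>y z. y \<bullet> z \<le> 1 / 2) cap"
      by (rule pairwise_subset[OF assms(3)]) (auto simp: cap_def)
  qed (use assms in \<open>auto simp: cap_def power2_eq_square\<close>)
  finally show ?thesis
    using assms by (simp add: sum.remove[OF assms(1,4)] norm_eq_1)
qed

lemma card_kissing_code_le:
  fixes X :: "(real ^ 10) set"
  assumes "finite X" "\<And>x. x \<in> X \<Longrightarrow> norm x = 1" "pairwise (\<lambda>x y. x \<bullet> y \<le> 1 / 2) X"
  shows "card X \<le> 594"
proof (rule ccontr)
  assume "\<not> card X \<le> 594"
  then have card: "595 \<le> real (card X)" by simp
  let ?S = "\<lambda>k. \<Sum>x\<in>X. \<Sum>y\<in>X. gegenbauer 10 k (x \<bullet> y)"
  have S0: "?S 0 = real (card X) * real (card X)"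
    by (simp add: gegenbauer_def geg_coeff_def)
  have nonneg: "0 \<le> ?S k" for k
    using gegenbauer_positive_definite[of X k] assms(2) by simp
  have "(\<Sum>x\<in>X. \<Sum>y\<in>X. lp_poly (x \<bullet> y)) =
      701888475 / 14 * ?S 0 + 2815510254 / 7 * ?S 1 + 48104680775 / 14 * ?S 2 + 29997510063 * ?S 3
    + 2831084999040 / 11 * ?S 4 + 22233242001312 / 11 * ?S 5
    + 150334459574400 / 11 * ?S 6 + 64064016737280 * ?S 7 + 589433241600 / 13 * ?S 8
    + 90296156160 * ?S 9 + 81266540544000 * ?S 10 + 1171408422017433600 * ?S 11"
    by (simp only: lp_poly_gegenbauer sum.distrib sum_distrib_left)
  then have "701888475 / 14 * (real (card X) * real (card X)) \<le> (\<Sum>x\<in>X. \<Sum>y\<in>X. lp_poly (x \<bullet> y))"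
    using nonneg[of 1] nonneg[of 2] nonneg[of 3] nonneg[of 4] nonneg[of 5] nonneg[of 6] nonneg[of 7]
      nonneg[of 8] nonneg[of 9] nonneg[of 10] nonneg[of 11] S0 by linarith
  also have "\<dots> \<le> (\<Sum>x\<in>X. lp_poly 1 + 19400000 * (144 / 17))"
    by (intro sum_mono lp_poly_row_sum_le assms)
  also have "\<dots> = real (card X) * (29665286739 + 19400000 * (144 / 17))"
    by (simp add: lp_poly_def)
  finally have "real (card X) * (701888475 / 14 * real (card X)) \<le> real (card X) * (29665286739 + 19400000 * (144 / 17))"
    by (simp add: mult_ac)
  then have "701888475 / 14 * real (card X) \<le> 29665286739 + 19400000 * (144 / 17)"
    by (rule mult_left_le_imp_le) (use card in linarith)
  \<comment> \<open>The quotient of the two constants is about 594.99.\<close>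
  with card show False by simp
qed

theorem theorem4p4:
  shows "kissing_number TYPE(10) \<le> 594"
proof -
  have "kissing_number TYPE(10) \<in> {card C | C :: (real ^ 10) set. kissing_configuration C}"
    unfolding kissing_number_def by (rule Max_in) (rule kissing_cards)+
  then obtain C :: "(real ^ 10) set"
    where C: "kissing_configuration C" "kissing_number TYPE(10) = card C" by blast
  define X where "X = (*\<^sub>R) (1 / 2) ` C"
  have "kissing_configuration ((*\<^sub>R) 2 ` X)"
    using C(1) by (simp add: X_def image_image)
  then have "card X \<le> 594"
    unfolding kissing_configuration_unit_vectors by (intro card_kissing_code_le) auto
  moreover have "card X = card C"
    unfolding X_def by (rule card_image) (simp add: inj_on_def)
  ultimately show ?thesis using C(2) by simp
qed

end
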